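(* Let $d\lambda$ be a measure on $\mathbb{R}$ having finite moments of all orders. Let $m,n$ be integers with $1\le m\le 2n$, let $\zeta_1,\dots,\zeta_M\in\mathbb{C}$ be distinct real or complex numbers such that $\zeta_\mu\neq 0$ and $1+\zeta_\mu t\neq 0$ for all $t\in\overline{\mathrm{supp}(d\lambda)}$, $\mu=1,\dots,M$, and let $s_1,\dots,s_M\ge 1$ be integers with $\sum_{\mu=1}^M s_\mu=m$. Define $$\omega_m(t)=\prod_{\mu=1}^M(1+\zeta_\mu t)^{s_\mu},$$ a polynomial of degree $m$. (Direct part.) Assume that the measure $d\lambda/\omega_m$ admits a (polynomial) $n$-point Gaussian quadrature formula $$\int_{\mathbb{R}} f(t)\,\frac{d\lambda(t)}{\omega_m(t)}=\sum_{\nu=1}^n w_\nu^G f(t_\nu^G)+R_n^G(f),\qquad R_n^G(f)=0\ \text{ for all } f\in\mathbb{P}_{2n-1},$$ with nodes $t_\nu^G\in\mathrm{supp}(d\lambda)$, $\nu=1,\dots,n$. Define $$t_\nu=t_\nu^G,\qquad \lambda_\nu=w_\nu^G\,\omega_m(t_\nu^G),\qquad \nu=1,2,\dots,n.$$ Then $$\int_{\mathbb{R}} g(t)\,d\lambda(t)=\sum_{\nu=1}^n\lambda_\nu g(t_\nu)+R_n(g),$$ where $R_n(g)=0$ whenever $g(t)=(1+\zeta_\mu t)^{-s}$ with $\mu\in\{1,\dots,M\}$ and $s\in\{1,\dots,s_\mu\}$, and $R_n(g)=0$ whenever $g\in\mathbb{P}_{2n-m-1}$. (Converse.) Conversely,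 suppose that $t_\nu\in\mathrm{supp}(d\lambda)$ and $\lambda_\nu$, $\nu=1,\dots,n$, are such that the quadrature formula $$\int_{\mathbb{R}} g(t)\,d\lambda(t)=\sum_{\nu=1}^n\lambda_\nu g(t_\nu)+R_n(g)$$ satisfies $R_n(g)=0$ for $g(t)=(1+\zeta_\mu t)^{-s}$, $\mu=1,\dots,M$, $s=1,\dots,s_\mu$, and for all $g\in\mathbb{P}_{2n-m-1}$. Then, with $t_\nu^G$ and $w_\nu^G$ defined by $t_\nu=t_\nu^G$ and $\lambda_\nu=w_\nu^G\,\omega_m(t_\nu^G)$ (that is, $t_\nu^G=t_\nu$ and $w_\nu^G=\lambda_\nu/\omega_m(t_\nu)$), one has $t_\nu^G\in\mathrm{supp}(d\lambda)$ and $$\int_{\mathbb{R}} f(t)\,\frac{d\lambda(t)}{\omega_m(t)}=\sum_{\nu=1}^n w_\nu^G f(t_\nu^G)\qquad\text{for all } f\in\mathbb{P}_{2n-1}.$$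
   Context: $\mathbb{P}_k$ denotes the space of polynomials of degree at most $k$; polynomials of degree $-1$ are understood to be identically zero, i.e. $\mathbb{P}_{-1}=\{0\}$ (this occurs when $m=2n$). $\mathrm{supp}(d\lambda)$ is the support of the measure $d\lambda$. The measure $d\lambda/\omega_m$ is $\omega_m(t)^{-1}d\lambda(t)$; it need not be positive, and may be complex-valued, since the $\zeta_\mu$ may be complex. Accordingly, the quadrature weights $w_\nu^G$ and $\lambda_\nu$ may be complex numbers. An $n$-point (polynomial) Gaussian quadrature formula for a measure is an $n$-point quadrature formula that is exact for all polynomials in $\mathbb{P}_{2n-1}$. The remainders $R_n^G(f)$ and $R_n(g)$ are defined as the difference between the integral and the corresponding quadrature sum. *)

theory Defs
  imports "HOL-Analysis.Analysis" "HOL-Computational_Algebra.Polynomial"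
begin

text \<open>Topological support: the complement of the union of all open null sets.\<close>

definition measure_support :: "'a::topological_space measure \<Rightarrow> 'a set" where
  "measure_support L = {x. \<forall>U. open U \<longrightarrow> x \<in> U \<longrightarrow> emeasure L U \<noteq> 0}"

text \<open>
  The bound on the degree is an integer because the bound \<open>-1\<close> occurs; as \<open>degree 0 = 0\<close>,
  the zero polynomial is admitted separately, so that \<open>polys_upto (-1) = {0}\<close>.
\<close>

definition polys_upto :: "int \<Rightarrow> complex poly set" where
  "polys_upto k = {p. p = 0 \<or> int (degree p) \<le> k}"

definition poly_fun :: "complex poly \<Rightarrow> real \<Rightarrow> complex" where
  "poly_fun p = (\<lambda>t. poly p (complex_of_real t))"

definition omega :: "nat \<Rightarrow> (nat \<Rightarrow> complex) \<Rightarrow> (nat \<Rightarrow> nat) \<Rightarrow> real \<Rightarrow> complex" where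
  "omega M \<zeta> s t = (\<Prod>\<mu>=1..M. (1 + \<zeta> \<mu> * complex_of_real t) ^ s \<mu>)"

text \<open>
  Integration against the complex measure \<open>dL / \<omega>\<close>, which has density \<open>1 / \<omega>\<close> with respect
  to the positive measure \<open>L\<close>.
\<close>

definition integral_over :: "real measure \<Rightarrow> (real \<Rightarrow> complex) \<Rightarrow> (real \<Rightarrow> complex) \<Rightarrow> complex" where
  "integral_over L \<omega> f = (LINT t|L. f t / \<omega> t)"

text \<open>
  Since both positive and complex measures occur, a measure enters a quadrature formula through
  its integration functional \<open>I\<close>.
\<close>

definition quad_remainder ::
  "((real \<Rightarrow> complex) \<Rightarrow> complex) \<Rightarrow> nat \<Rightarrow> (nat \<Rightarrow> real) \<Rightarrow> (nat \<Rightarrow> complex)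
    \<Rightarrow> (real \<Rightarrow> complex) \<Rightarrow> complex" where
  "quad_remainder I n t w f = I f - (\<Sum>\<nu>=1..n. w \<nu> * f (t \<nu>))"

definition gaussian_quadrature ::
  "((real \<Rightarrow> complex) \<Rightarrow> complex) \<Rightarrow> nat \<Rightarrow> (nat \<Rightarrow> real) \<Rightarrow> (nat \<Rightarrow> complex) \<Rightarrow> bool" where
  "gaussian_quadrature I n t w \<longleftrightarrow>
     (\<forall>f \<in> polys_upto (2 * int n - 1). quad_remainder I n t w (poly_fun f) = 0)"

end

theory Submission
  imports Defs
begin

text \<open>
  Division by \<open>\<omega>\<close> carries \<open>\<P>\<^bsub>2n-1\<^esub>\<close>, tested against \<open>dL / \<omega>\<close>, to the
  span of the \<open>(1 + \<zeta>\<^sub>\<mu> t) ^ (-k)\<close> and \<open>\<P>\<^bsub>2n-m-1\<^esub>\<close>, tested against \<open>dL\<close>. In one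
  direction this is the observation that \<open>\<omega> / (1 + \<zeta>\<^sub>\<mu> t) ^ k\<close> and \<open>\<omega> g\<close> are polynomials
  of degree at most \<open>2n - 1\<close>; in the other, it is division by \<open>\<omega>\<close> with remainder followed by a
  partial fraction decomposition. All integrals exist because the complement of the support is
  a null set and \<open>1 / \<omega>\<close> is bounded on the support.
\<close>

section \<open>The support of a measure\<close>

text \<open>Closedness is what later gives a pole off the support a positive distance from
  it.\<close>

lemma closed_measure_support: "closed (measure_support L)"
proof -
  have "- measure_support L = \<Union>{U. open U \<and> emeasure L U = 0}"
    by (auto simp: measure_support_def)
  then have "open (- measure_support L)"
    by (metis (no_types, lifting) mem_Collect_eq open_Union)
  then show ?thesis
    by (simp add: closed_def)
qed

text \<open>The family of all open null sets may be uncountable; by Lindelof, countably many of them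
  have the same union, which is therefore null.\<close>

lemma AE_in_measure_support:
  fixes L :: "'a::second_countable_topology measure"
  assumes "sets L = sets borel"
  shows "AE x in L. x \<in> measure_support L"
proof -
  let ?F = "{U. open U \<and> emeasure L U = 0}"
  obtain F' where F': "F' \<subseteq> ?F" "countable F'" "\<Union>F' = \<Union>?F"
    by (rule Lindelof[of ?F]) auto
  have "(\<Union>U\<in>F'. U) \<in> null_sets L"
    using F'(1,2) assms by (intro null_sets_UN') (auto simp: null_sets_def)
  moreover have "x \<in> \<Union>F'" if "x \<notin> measure_support L" for x
    using that F'(3) by (auto simp: measure_support_def)
  ultimately show ?thesis
    by (intro AE_I'[of "\<Union>F'"]) auto
qed

section \<open>Partial fractions\<close>

text \<open>For \<open>k \<le> s i\<close> this is the numerator of \<open>(1 + \<zeta> i * x) ^ (-k)\<close> over the common denominator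
  \<open>\<Prod>j\<in>A. (1 + \<zeta> j * x) ^ s j\<close>.\<close>

definition cofactor :: "'i set \<Rightarrow> ('i \<Rightarrow> 'a::field) \<Rightarrow> ('i \<Rightarrow> nat) \<Rightarrow> 'i \<Rightarrow> nat \<Rightarrow> 'a poly" where
  "cofactor A \<zeta> s i k = (\<Prod>j\<in>A. [:1, \<zeta> j:] ^ (s j - (if j = i then k else 0)))"

lemma cofactor_mult_power:
  assumes "finite A" "i \<in> A" "k \<le> s i"
  shows "cofactor A \<zeta> s i k * [:1, \<zeta> i:] ^ k = (\<Prod>j\<in>A. [:1, \<zeta> j:] ^ s j)"
proof -
  have "(\<Prod>j\<in>A - {i}. [:1, \<zeta> j:] ^ (s j - (if j = i then k else 0))) = (\<Prod>j\<in>A - {i}. [:1, \<zeta> j:] ^ s j)"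
    by (intro prod.cong) auto
  moreover have "[:1, \<zeta> i:] ^ (s i - k) * [:1, \<zeta> i:] ^ k = [:1, \<zeta> i:] ^ s i"
    using assms(3) by (simp flip: power_add)
  ultimately show ?thesis
    unfolding cofactor_def prod.remove[OF assms(1,2)] by (simp add: mult_ac)
qed

lemma degree_prod_linear_powers:
  fixes \<zeta> :: "'i \<Rightarrow> 'a::field"
  assumes "\<And>j. j \<in> A \<Longrightarrow> \<zeta> j \<noteq> 0"
  shows "degree (\<Prod>j\<in>A. [:1, \<zeta> j:] ^ s j) = sum s A"
  using assms by (subst degree_prod_eq_sum_degree) (auto simp: degree_power_eq)

lemma prod_linear_powers_nonzero:
  fixes \<zeta> :: "'i \<Rightarrow> 'a::field"
  shows "(\<Prod>j\<in>A. [:1, \<zeta> j:] ^ s j) \<noteq> 0"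
  by (cases "finite A") auto

text \<open>Subtracting a multiple of the cofactor with the highest power of \<open>1 + \<zeta> i * x\<close> makes \<open>r\<close>
  divisible by \<open>1 + \<zeta> i * x\<close>, which lowers \<open>s i\<close> by one.\<close>

lemma partial_fraction_induct:
  fixes \<zeta> :: "'i \<Rightarrow> 'a::field"
  assumes A: "finite A" "inj_on \<zeta> A" "\<And>i. i \<in> A \<Longrightarrow> \<zeta> i \<noteq> 0"
    and r: "r = 0 \<or> degree r < sum s A"
    and zero: "P 0" and add: "\<And>p q. P p \<Longrightarrow> P q \<Longrightarrow> P (p + q)"
    and smult: "\<And>c p. P p \<Longrightarrow> P (smult c p)"
    and cofactor: "\<And>i k. i \<in> A \<Longrightarrow> 1 \<le> k \<Longrightarrow> k \<le> s i \<Longrightarrow> P (cofactor A \<zeta> s i k)"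
  shows "P r"
  using r zero add smult cofactor
\<comment> \<open>\<open>P\<close> has to vary: the induction hypothesis is used for
  \<open>\<lambda>p. P (?l * p)\<close>, since \<open>?l\<close> times a cofactor for the lowered
  exponents is a cofactor for \<open>s\<close>.\<close>
proof (induction "sum s A" arbitrary: s P r)
  case 0
  then show ?case by auto
next
  case (Suc N)
  note P = Suc.prems
  obtain i where i: "i \<in> A" "s i \<ge> 1"
    using Suc.hyps(2) by (metis less_one not_le sum.neutral Zero_not_Suc)
  define s' where "s' = s(i := s i - 1)"
  let ?l = "[:1, \<zeta> i:]"
  let ?x = "- 1 / \<zeta> i"
  let ?C = "cofactor A \<zeta> s i (s i)"
  have zi: "\<zeta> i \<noteq> 0" using A(3) i(1) .
  have s': "sum s' A = N"
    using Suc.hyps(2) i A(1) by (simp add: s'_def sum.remove)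
  \<comment> \<open>By injectivity of \<open>\<zeta>\<close>, among the linear factors only
    \<open>?l\<close> vanishes at \<open>?x\<close>, and it enters \<open>?C\<close> with exponent
    0.\<close>
  have "poly ?C ?x \<noteq> 0"
  proof -
    have "1 + \<zeta> j * ?x \<noteq> 0" if "j \<in> A" "j \<noteq> i" for j
      using that A(2) i(1) zi by (auto simp: field_simps inj_on_eq_iff)
    then show ?thesis
      using A(1) by (auto simp: cofactor_def poly_prod mult.commute)
  qed
  \<comment> \<open>The one scalar for which \<open>r - smult c ?C\<close> vanishes at the root
    \<open>?x\<close> of \<open>?l\<close>.\<close>
  define c where "c = poly r ?x / poly ?C ?x"
  have "poly (r - smult c ?C) ?x = 0"
    using \<open>poly ?C ?x \<noteq> 0\<close> by (simp add: c_def)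
  moreover have "[:- ?x, 1:] = smult (1 / \<zeta> i) ?l"
    using zi by simp
  ultimately have "?l dvd r - smult c ?C"
    using zi by (metis poly_eq_0_iff_dvd smult_dvd_iff divide_eq_0_iff zero_neq_one)
  then obtain q where q: "r - smult c ?C = ?l * q" by (elim dvdE)
  have "degree ?C + s i = Suc N"
  proof -
    have "degree (?C * ?l ^ s i) = Suc N"
      using cofactor_mult_power[of A i "s i" s \<zeta>] degree_prod_linear_powers[of A \<zeta> s] A i Suc.hyps(2)
      by simp
    moreover have "?C \<noteq> 0" using \<open>poly ?C ?x \<noteq> 0\<close> by auto
    ultimately show ?thesis using zi by (simp add: degree_mult_eq degree_power_eq)
  qed
  moreover have "degree (r - smult c ?C) \<le> max (degree r) (degree ?C)"
    by (meson degree_diff_le_max degree_smult_le max.mono order_refl order_trans)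
  \<comment> \<open>As \<open>s i\<close> is at least 1, the degree of \<open>?C\<close> is strictly
    below \<open>Suc N\<close>, so the subtraction keeps the degree bound of
    \<open>r\<close>.\<close>
  ultimately have "degree (?l * q) < Suc N"
    using P(1) Suc.hyps(2) i(2) q by (auto simp: max_def split: if_splits)
  then have qdeg: "q = 0 \<or> degree q < sum s' A"
    using zi s' by (cases "q = 0") (auto simp: degree_mult_eq simp del: mult_pCons_left)
  have "P (?l * q)"
  proof (rule Suc.hyps(1)[where P = "\<lambda>p. P (?l * p)", OF s'[symmetric] qdeg])
    fix j k assume jk: "j \<in> A" "1 \<le> k" "k \<le> s' j"
    have "?l * cofactor A \<zeta> s' j k = cofactor A \<zeta> s j k"
    proof -
      have "(\<Prod>a\<in>A - {i}. [:1, \<zeta> a:] ^ (s' a - (if a = j then k else 0)))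
          = (\<Prod>a\<in>A - {i}. [:1, \<zeta> a:] ^ (s a - (if a = j then k else 0)))"
        by (intro prod.cong) (auto simp: s'_def)
      \<comment> \<open>The subtraction is truncated. For \<open>j = i\<close> the bound
        \<open>k \<le> s i - 1\<close> leaves at least one factor \<open>?l\<close> to split
        off.\<close>
      moreover have "s i - (if i = j then k else 0) = Suc (s' i - (if i = j then k else 0))"
        using jk i(2) by (auto simp: s'_def)
      ultimately show ?thesis
        unfolding cofactor_def prod.remove[OF A(1) i(1)] by (simp only: power_Suc mult.assoc)
    qed
    moreover have "k \<le> s j" using jk by (auto simp: s'_def split: if_splits)
    ultimately show "P (?l * cofactor A \<zeta> s' j k)"
      using P(5) jk by simp
  qed (use P in \<open>auto simp: distrib_left simp del: mult_pCons_left\<close>)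
  moreover have "P (smult c ?C)"
    using P(4,5) i by simp
  ultimately have "P (?l * q + smult c ?C)" by (rule P(3))
  then show ?case unfolding q[symmetric] by simp
qed

section \<open>Integrability\<close>

lemma integrable_poly_fun:
  assumes "\<And>k::nat. integrable L (\<lambda>t::real. t ^ k)"
  shows "integrable L (poly_fun p)"
proof -
  have "integrable L (\<lambda>t. coeff p i * complex_of_real (t ^ i))" for i
    by (intro integrable_mult_right integrable_of_real assms)
  then show ?thesis
    unfolding poly_fun_def poly_altdef by simp
qed

lemma borel_measurable_poly_fun: "poly_fun p \<in> borel_measurable borel"
  unfolding poly_fun_def by (intro borel_measurable_continuous_onI continuous_intros)

lemma linear_factor_bounded_below:
  fixes S :: "real set"
  assumes "closed S" "z \<noteq> 0" "\<And>t. t \<in> S \<Longrightarrow> 1 + z * complex_of_real t \<noteq> 0"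
  obtains d where "d > 0" "\<And>t. t \<in> S \<Longrightarrow> d \<le> norm (1 + z * complex_of_real t)"
proof -
  have "closed (complex_of_real ` S)"
    using assms(1)
    by (intro closed_injective_linear_image) (auto intro: injI bounded_linear.linear bounded_linear_of_real)
  moreover have "- 1 / z \<notin> complex_of_real ` S"
  proof
    assume "- 1 / z \<in> complex_of_real ` S"
    then obtain t where t: "t \<in> S" "- 1 / z = complex_of_real t" by (elim imageE)
    have "1 + z * (- 1 / z) = 0" using assms(2) by simp
    then show False using assms(3)[OF t(1)] unfolding t(2) by contradiction
  qed
  ultimately obtain d where d: "d > 0" "\<And>x. x \<in> complex_of_real ` S \<Longrightarrow> d \<le> dist (- 1 / z) x"
    by (metis separate_point_closed)
  have "norm z * d \<le> norm (1 + z * complex_of_real t)" if "t \<in> S" for t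
  proof -
    have "1 + z * complex_of_real t = - z * (- 1 / z - complex_of_real t)"
      using assms(2) by (simp add: field_simps)
    then have "norm (1 + z * complex_of_real t) = norm z * dist (- 1 / z) (complex_of_real t)"
      unfolding dist_norm by (simp only: norm_mult norm_minus_cancel)
    then show ?thesis using d(2) that by (simp add: mult_left_mono)
  qed
  then show thesis using that[of "norm z * d"] d(1) assms(2) by simp
qed

text \<open>The quotient is dominated almost everywhere by \<open>f / d\<close>.\<close>

lemma integrable_divide_bounded_below:
  fixes f g :: "'a \<Rightarrow> complex"
  assumes "integrable L f" "g \<in> borel_measurable L" "d > 0" "AE x in L. d \<le> norm (g x)"
  shows "integrable L (\<lambda>x. f x / g x)"
proof (rule Bochner_Integration.integrable_bound)
  show "integrable L (\<lambda>x. f x / complex_of_real d)" using assms(1) by simp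
  show "(\<lambda>x. f x / g x) \<in> borel_measurable L" using assms(1,2) by measurable
  show "AE x in L. norm (f x / g x) \<le> norm (f x / complex_of_real d)"
    using assms(4) by eventually_elim (use assms(3) in \<open>auto simp: norm_divide intro!: divide_left_mono mult_pos_pos\<close>)
qed

section \<open>Transfer between the two quadrature formulas\<close>

text \<open>Equality of \<open>h\<close> and \<open>f / \<omega>\<close> on the support is enough:
  the integrals see only the support up to a null set, the sums see only nodes in it, and there the
  factor \<open>\<omega>\<close> in \<open>lam\<close> cancels the denominator.\<close>

lemma quad_remainder_transfer:
  assumes L: "sets L = sets borel"
    and nodes: "\<And>\<nu>. \<nu> \<in> {1..n} \<Longrightarrow>
      t \<nu> = tG \<nu> \<and> tG \<nu> \<in> measure_support L \<and> lam \<nu> = wG \<nu> * \<omega> (tG \<nu>)"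
    and nz: "\<And>x. x \<in> measure_support L \<Longrightarrow> \<omega> x \<noteq> 0"
    and eq: "\<And>x. x \<in> measure_support L \<Longrightarrow> h x = f x / \<omega> x"
    and meas: "h \<in> borel_measurable borel" "f \<in> borel_measurable borel" "\<omega> \<in> borel_measurable borel"
  shows "quad_remainder (integral\<^sup>L L) n t lam h = quad_remainder (integral_over L \<omega>) n tG wG f"
proof -
  have "integral\<^sup>L L h = (LINT x|L. f x / \<omega> x)"
  proof (rule integral_cong_AE)
    show "AE x in L. h x = f x / \<omega> x"
      using AE_in_measure_support[OF L] by eventually_elim (rule eq)
    show "h \<in> borel_measurable L" "(\<lambda>x. f x / \<omega> x) \<in> borel_measurable L"
      using meas by (auto simp: measurable_cong_sets[OF L refl])
  qed
  moreover have "(\<Sum>\<nu>=1..n. lam \<nu> * h (t \<nu>)) = (\<Sum>\<nu>=1..n. wG \<nu> * f (tG \<nu>))"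
    using nodes nz by (intro sum.cong) (auto simp: eq)
  ultimately show ?thesis
    by (simp add: quad_remainder_def integral_over_def)
qed

text \<open>Integrability is assumed because the integral of a non-integrable function has the
  default value 0, which would break additivity.\<close>

lemma quad_remainder_add:
  assumes "integrable L (\<lambda>x. f x / \<omega> x)" "integrable L (\<lambda>x. g x / \<omega> x)"
  shows "quad_remainder (integral_over L \<omega>) n t w (\<lambda>x. f x + g x) =
    quad_remainder (integral_over L \<omega>) n t w f + quad_remainder (integral_over L \<omega>) n t w g"
  using assms
  by (simp add: quad_remainder_def integral_over_def add_divide_distrib distrib_left sum.distrib)

lemma quad_remainder_cmult:
  "quad_remainder (integral_over L \<omega>) n t w (\<lambda>x. c * f x) = c * quad_remainder (integral_over L \<omega>) n t w f"
  by (simp add: quad_remainder_def integral_over_def sum_distrib_left right_diff_distrib mult_ac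
      flip: times_divide_eq_right)

theorem theorem1p1:
  fixes L :: "real measure"
    and m n M :: nat
    and \<zeta> :: "nat \<Rightarrow> complex"
    and s :: "nat \<Rightarrow> nat"
  assumes "sets L = sets borel"
    and "\<And>k::nat. integrable L (\<lambda>t. t ^ k)"
    and "1 \<le> m" and "m \<le> 2 * n"
    and "inj_on \<zeta> {1..M}"
    and "\<And>\<mu>. \<mu> \<in> {1..M} \<Longrightarrow> \<zeta> \<mu> \<noteq> 0"
    and "\<And>\<mu> t. \<mu> \<in> {1..M} \<Longrightarrow> t \<in> closure (measure_support L) \<Longrightarrow>
           1 + \<zeta> \<mu> * complex_of_real t \<noteq> 0"
    and "\<And>\<mu>. \<mu> \<in> {1..M} \<Longrightarrow> 1 \<le> s \<mu>"
    and "(\<Sum>\<mu>=1..M. s \<mu>) = m"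
  shows
    \<comment> \<open>all integrals below exist\<close>
    "((\<forall>f \<in> polys_upto (2 * int n - 1). integrable L (\<lambda>t. poly_fun f t / omega M \<zeta> s t)) \<and>
      (\<forall>\<mu> \<in> {1..M}. \<forall>k \<in> {1..s \<mu>}.
         integrable L (\<lambda>t. 1 / (1 + \<zeta> \<mu> * complex_of_real t) ^ k)) \<and>
      (\<forall>g \<in> polys_upto (2 * int n - int m - 1). integrable L (poly_fun g)))
    \<and>
    \<comment> \<open>direct part\<close>
     (\<forall>tG wG t lam.
        (\<forall>\<nu> \<in> {1..n}. tG \<nu> \<in> measure_support L) \<longrightarrow>
        gaussian_quadrature (integral_over L (omega M \<zeta> s)) n tG wG \<longrightarrow>
        (\<forall>\<nu> \<in> {1..n}. t \<nu> = tG \<nu> \<and> lam \<nu> = wG \<nu> * omega M \<zeta> s (tG \<nu>)) \<longrightarrow>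
        (\<forall>\<mu> \<in> {1..M}. \<forall>k \<in> {1..s \<mu>}.
           quad_remainder (integral\<^sup>L L) n t lam
             (\<lambda>x. 1 / (1 + \<zeta> \<mu> * complex_of_real x) ^ k) = 0) \<and>
        (\<forall>g \<in> polys_upto (2 * int n - int m - 1).
           quad_remainder (integral\<^sup>L L) n t lam (poly_fun g) = 0))
    \<and>
    \<comment> \<open>converse\<close>
     (\<forall>t lam tG wG.
        (\<forall>\<nu> \<in> {1..n}. t \<nu> \<in> measure_support L) \<longrightarrow>
        (\<forall>\<mu> \<in> {1..M}. \<forall>k \<in> {1..s \<mu>}.
           quad_remainder (integral\<^sup>L L) n t lam
             (\<lambda>x. 1 / (1 + \<zeta> \<mu> * complex_of_real x) ^ k) = 0) \<longrightarrow>
        (\<forall>g \<in> polys_upto (2 * int n - int m - 1).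
           quad_remainder (integral\<^sup>L L) n t lam (poly_fun g) = 0) \<longrightarrow>
        (\<forall>\<nu> \<in> {1..n}. tG \<nu> = t \<nu> \<and> wG \<nu> = lam \<nu> / omega M \<zeta> s (t \<nu>)) \<longrightarrow>
        (\<forall>\<nu> \<in> {1..n}. tG \<nu> \<in> measure_support L) \<and>
        (\<forall>f \<in> polys_upto (2 * int n - 1).
           integral_over L (omega M \<zeta> s) (poly_fun f) =
             (\<Sum>\<nu>=1..n. wG \<nu> * poly_fun f (tG \<nu>))))"
proof -

  \<comment> \<open>The denominator as a polynomial, and its cofactors\<close>
  note L = assms(1) and moments = assms(2)
  let ?S = "measure_support L" and ?A = "{1..M}"
  let ?\<omega> = "omega M \<zeta> s"
  let ?C = "cofactor ?A \<zeta> s"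
  let ?R = "quad_remainder (integral\<^sup>L L) n"
  let ?G = "quad_remainder (integral_over L ?\<omega>) n"
  \<comment> \<open>The polynomial behind \<open>omega\<close>, for which degrees and division with
    remainder are available.\<close>
  define W where "W = (\<Prod>\<mu>\<in>?A. [:1, \<zeta> \<mu>:] ^ s \<mu>)"
  have \<omega>_W: "?\<omega> = poly_fun W"
    by (simp add: fun_eq_iff omega_def poly_fun_def W_def poly_prod mult.commute)
  have W: "degree W = m" "W \<noteq> 0"
    using degree_prod_linear_powers[of ?A \<zeta> s] prod_linear_powers_nonzero[of \<zeta> s ?A] assms(6,9)
    by (simp_all add: W_def)
  have nz: "1 + \<zeta> \<mu> * complex_of_real x \<noteq> 0" if "\<mu> \<in> ?A" "x \<in> ?S" for \<mu> x
    using assms(7) that closure_subset by blast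
  have \<omega>_nz: "?\<omega> x \<noteq> 0" if "x \<in> ?S" for x
    using nz that by (auto simp: omega_def)
  have C_fun: "1 / (1 + \<zeta> \<mu> * complex_of_real x) ^ k = poly_fun (?C \<mu> k) x / ?\<omega> x"
    if "\<mu> \<in> ?A" "k \<in> {1..s \<mu>}" "x \<in> ?S" for \<mu> k x
  proof -
    have "?C \<mu> k * [:1, \<zeta> \<mu>:] ^ k = W"
      using that cofactor_mult_power[of ?A \<mu> k s \<zeta>] by (simp add: W_def)
    then have "?\<omega> x = poly_fun (?C \<mu> k) x * (1 + \<zeta> \<mu> * complex_of_real x) ^ k"
      unfolding \<omega>_W poly_fun_def by (auto simp: mult.commute)
    then show ?thesis
      using \<omega>_nz[OF that(3)] nz[OF that(1,3)] by (simp add: field_simps)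
  qed
  have C_deg: "?C \<mu> k \<in> polys_upto (2 * int n - 1)" if "\<mu> \<in> ?A" "k \<in> {1..s \<mu>}" for \<mu> k
  proof -
    have "?C \<mu> k * [:1, \<zeta> \<mu>:] ^ k = W"
      using that cofactor_mult_power[of ?A \<mu> k s \<zeta>] by (simp add: W_def)
    then have "degree (?C \<mu> k) + k = m"
      using W assms(6)[OF that(1)] by (auto simp: degree_mult_eq degree_power_eq)
    \<comment> \<open>The degree is \<open>m - k\<close>, which is at most \<open>2n - 1\<close>
      because \<open>k \<ge> 1\<close> and \<open>m \<le> 2n\<close>.\<close>
    then show ?thesis using that(2) assms(4) by (auto simp: polys_upto_def)
  qed
  have meas_frac: "(\<lambda>x. 1 / (1 + \<zeta> \<mu> * complex_of_real x) ^ k) \<in> borel_measurable borel" for \<mu> k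
    by measurable
  have meas_\<omega>: "?\<omega> \<in> borel_measurable borel"
    unfolding \<omega>_W by (rule borel_measurable_poly_fun)

  \<comment> \<open>Existence of the integrals\<close>
  have "\<exists>d>0. \<forall>x\<in>?S. d \<le> norm (1 + \<zeta> \<mu> * complex_of_real x)" if "\<mu> \<in> ?A" for \<mu>
    by (rule linear_factor_bounded_below[OF closed_measure_support assms(6)[OF that] nz[OF that]]) auto
  then obtain d where d: "\<And>\<mu>. \<mu> \<in> ?A \<Longrightarrow> d \<mu> > 0"
      "\<And>\<mu> x. \<mu> \<in> ?A \<Longrightarrow> x \<in> ?S \<Longrightarrow> d \<mu> \<le> norm (1 + \<zeta> \<mu> * complex_of_real x)"
    by metis
  have int_poly: "integrable L (poly_fun p)" for p
    by (rule integrable_poly_fun[OF moments])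
  have int_\<omega>: "integrable L (\<lambda>x. poly_fun p x / ?\<omega> x)" for p
  proof (rule integrable_divide_bounded_below[OF int_poly])
    show "?\<omega> \<in> borel_measurable L"
      using meas_\<omega> by (simp add: measurable_cong_sets[OF L refl])
    \<comment> \<open>The lower bounds of the linear factors multiply to a lower bound of
      \<open>norm (?\<omega> x)\<close>.\<close>
    show "(\<Prod>\<mu>\<in>?A. d \<mu> ^ s \<mu>) > 0" using d(1) by (intro prod_pos) auto
    show "AE x in L. (\<Prod>\<mu>\<in>?A. d \<mu> ^ s \<mu>) \<le> norm (?\<omega> x)"
      using AE_in_measure_support[OF L]
    proof eventually_elim
      case (elim x)
      then show ?case
        unfolding omega_def prod_norm[symmetric] norm_power
        using d by (intro prod_mono conjI power_mono zero_le_power) (auto intro: less_imp_le)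
    qed
  qed
  have int_frac: "integrable L (\<lambda>x. 1 / (1 + \<zeta> \<mu> * complex_of_real x) ^ k)"
    if "\<mu> \<in> ?A" "k \<in> {1..s \<mu>}" for \<mu> k
  proof -
    \<comment> \<open>The identity is claimed only almost everywhere, as denominators may vanish off
      the support.\<close>
    have "AE x in L. poly_fun (?C \<mu> k) x / ?\<omega> x = 1 / (1 + \<zeta> \<mu> * complex_of_real x) ^ k"
      using AE_in_measure_support[OF L] by eventually_elim (rule C_fun[OF that, symmetric])
    then show ?thesis
      using int_\<omega>[of "?C \<mu> k"] meas_frac[of \<mu> k] meas_\<omega> borel_measurable_poly_fun[of "?C \<mu> k"]
      by (subst (asm) integrable_cong_AE) (auto simp: measurable_cong_sets[OF L refl])
  qed

  \<comment> \<open>Matching remainders for simple fractions and polynomials\<close>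
  have R_frac: "?R t lam (\<lambda>x. 1 / (1 + \<zeta> \<mu> * complex_of_real x) ^ k) = ?G tG wG (poly_fun (?C \<mu> k))"
    if "\<And>\<nu>. \<nu> \<in> {1..n} \<Longrightarrow> t \<nu> = tG \<nu> \<and> tG \<nu> \<in> ?S \<and> lam \<nu> = wG \<nu> * ?\<omega> (tG \<nu>)"
      and "\<mu> \<in> ?A" "k \<in> {1..s \<mu>}" for t tG lam wG \<mu> k
    by (rule quad_remainder_transfer[OF L that(1) \<omega>_nz C_fun meas_frac borel_measurable_poly_fun meas_\<omega>])
      (use that in auto)
  \<comment> \<open>On the support, \<open>g\<close> is the quotient of \<open>g * W\<close> by
    \<open>\<omega>\<close>.\<close>
  have R_poly: "?R t lam (poly_fun g) = ?G tG wG (poly_fun (g * W))"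
    if "\<And>\<nu>. \<nu> \<in> {1..n} \<Longrightarrow> t \<nu> = tG \<nu> \<and> tG \<nu> \<in> ?S \<and> lam \<nu> = wG \<nu> * ?\<omega> (tG \<nu>)"
    for t tG lam wG g
    by (rule quad_remainder_transfer[OF L that \<omega>_nz _ borel_measurable_poly_fun borel_measurable_poly_fun meas_\<omega>])
      (use \<omega>_nz \<omega>_W in \<open>auto simp: poly_fun_def\<close>)

  \<comment> \<open>Converse: division by \<open>W\<close> and partial fractions\<close>
  have converse: "?G tG wG (poly_fun f) = 0"
    if nodes: "\<And>\<nu>. \<nu> \<in> {1..n} \<Longrightarrow> t \<nu> = tG \<nu> \<and> tG \<nu> \<in> ?S \<and> lam \<nu> = wG \<nu> * ?\<omega> (tG \<nu>)"
      and frac: "\<And>\<mu> k. \<mu> \<in> ?A \<Longrightarrow> k \<in> {1..s \<mu>} \<Longrightarrow>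
        ?R t lam (\<lambda>x. 1 / (1 + \<zeta> \<mu> * complex_of_real x) ^ k) = 0"
      and polys: "\<And>g. g \<in> polys_upto (2 * int n - int m - 1) \<Longrightarrow> ?R t lam (poly_fun g) = 0"
      and f: "f \<in> polys_upto (2 * int n - 1)"
    for t tG lam wG f
  proof -
    let ?P = "\<lambda>p. ?G tG wG (poly_fun p) = 0"
    have add: "?P (p + q)" if "?P p" "?P q" for p q
      using that quad_remainder_add[OF int_\<omega> int_\<omega>, of n tG wG p q] by (simp add: poly_fun_def)
    have smult: "?P (smult c p)" if "?P p" for c p
      using that quad_remainder_cmult[of L ?\<omega> n tG wG c "poly_fun p"] by (simp add: poly_fun_def)
    \<comment> \<open>The remainder is 0 or has degree below \<open>m\<close>, the sum of the
      \<open>s \<mu>\<close>, so it is a combination of cofactors. Each cofactor satisfies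
      \<open>?P\<close> by exactness on the matching fraction.\<close>
    have "?P (f mod W)"
    proof (rule partial_fraction_induct[where P = ?P, OF _ assms(5,6)])
      show "f mod W = 0 \<or> degree (f mod W) < sum s ?A"
        using degree_mod_less[of W f] W assms(9) by simp
      show "?P 0" by (simp add: quad_remainder_def integral_over_def poly_fun_def)
      show "?P (?C \<mu> k)" if "\<mu> \<in> ?A" "1 \<le> k" "k \<le> s \<mu>" for \<mu> k
        using frac[of \<mu> k] R_frac[of t tG lam wG \<mu> k] nodes that by simp
    qed (simp_all add: add smult)
    moreover have "f div W \<in> polys_upto (2 * int n - int m - 1)"
    \<comment> \<open>A zero quotient lies in \<open>polys_upto\<close> for every bound, including
      \<open>-1\<close>, which occurs when \<open>m = 2n\<close>.\<close>
    proof (cases "f div W = 0")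
      case False
      then have "degree (f div W * W) = degree (f div W) + m"
        using W by (simp add: degree_mult_eq)
      \<comment> \<open>The remainder has too small a degree to cancel the leading term, so the
        quotient has degree exactly \<open>degree f - m\<close>.\<close>
      moreover have "degree (f div W * W + f mod W) = degree (f div W * W)"
      proof (cases "f mod W = 0")
        case False
        then show ?thesis
          using degree_mod_less[of W f] W calculation by (intro degree_add_eq_left) simp
      qed simp
      ultimately have "degree (f div W) + m = degree f" "f \<noteq> 0"
        using False by auto
      then show ?thesis using f by (auto simp: polys_upto_def)
    qed (simp add: polys_upto_def)
    then have "?P (f div W * W)"
      using polys R_poly[of t tG lam wG "f div W"] nodes by simp
    ultimately show ?thesis using add[of "f div W * W" "f mod W"] by simp
  qed

  \<comment> \<open>Both directions from the matched remainders\<close>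
  show ?thesis
  proof (intro conjI allI impI ballI)
    fix tG wG t lam \<mu> k
    assume "\<forall>\<nu>\<in>{1..n}. tG \<nu> \<in> ?S" "gaussian_quadrature (integral_over L ?\<omega>) n tG wG"
      "\<forall>\<nu>\<in>{1..n}. t \<nu> = tG \<nu> \<and> lam \<nu> = wG \<nu> * ?\<omega> (tG \<nu>)" "\<mu> \<in> ?A" "k \<in> {1..s \<mu>}"
    then show "?R t lam (\<lambda>x. 1 / (1 + \<zeta> \<mu> * complex_of_real x) ^ k) = 0"
      using C_deg by (subst R_frac[of t tG lam wG]) (auto simp: gaussian_quadrature_def)
  next
    fix tG wG t lam g
    assume *: "\<forall>\<nu>\<in>{1..n}. tG \<nu> \<in> ?S" "gaussian_quadrature (integral_over L ?\<omega>) n tG wG"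
      "\<forall>\<nu>\<in>{1..n}. t \<nu> = tG \<nu> \<and> lam \<nu> = wG \<nu> * ?\<omega> (tG \<nu>)" "g \<in> polys_upto (2 * int n - int m - 1)"
    \<comment> \<open>Multiplication by \<open>W\<close> raises the degree by \<open>m\<close>, from
      at most \<open>2n - m - 1\<close> to at most \<open>2n - 1\<close>.\<close>
    have "g * W \<in> polys_upto (2 * int n - 1)"
      using *(4) W by (cases "g = 0") (auto simp: polys_upto_def degree_mult_eq)
    then show "?R t lam (poly_fun g) = 0"
      using * by (subst R_poly[of t tG lam wG]) (auto simp: gaussian_quadrature_def)
  next
    fix t lam tG wG f
    assume *: "\<forall>\<nu>\<in>{1..n}. t \<nu> \<in> ?S"
      "\<forall>\<mu>\<in>?A. \<forall>k\<in>{1..s \<mu>}. ?R t lam (\<lambda>x. 1 / (1 + \<zeta> \<mu> * complex_of_real x) ^ k) = 0"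
      "\<forall>g\<in>polys_upto (2 * int n - int m - 1). ?R t lam (poly_fun g) = 0"
      "\<forall>\<nu>\<in>{1..n}. tG \<nu> = t \<nu> \<and> wG \<nu> = lam \<nu> / ?\<omega> (t \<nu>)" "f \<in> polys_upto (2 * int n - 1)"
    \<comment> \<open>The weights \<open>lam \<nu> / ?\<omega> (t \<nu>)\<close> invert the relation
      in \<open>converse\<close>, as \<open>?\<omega>\<close> does not vanish at nodes in the
      support.\<close>
    then have "?G tG wG (poly_fun f) = 0"
      by (intro converse[of t tG lam wG]) (auto simp: \<omega>_nz)
    then show "integral_over L ?\<omega> (poly_fun f) = (\<Sum>\<nu>=1..n. wG \<nu> * poly_fun f (tG \<nu>))"
      by (simp add: quad_remainder_def)
  qed (auto intro: int_poly int_\<omega> int_frac)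
qed

end
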